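(* Let $N\ge2$ and $T\ge1$ be integers, and let $l_{i,t}$ (losses) and $\alpha_{i,t}$, $1\le i\le N$, $1\le t\le T$, be real numbers, fixed in advance (oblivious adversary), such that $l_{i,t}-\alpha_{i,t}\ge0$ for every $i$ and $t$. Write $\boldsymbol{\alpha}_t=(\alpha_{1,t},\ldots,\alpha_{N,t})$. Let $\mathcal{Q}_\alpha>0$ be an upper bound on $$\frac{1}{2} q(\boldsymbol{\alpha}_{1:T})+2\sum_{t=1}^T \sum_{i=1}^N (l_{i,t}-\alpha_{i,t})^2+4\sum_{t=1}^T \max_i\{l_{i,t}-\alpha_{i,t}\}\cdot d(\boldsymbol{\alpha}_t).$$ Then for $\eta = \sqrt{4\log N/\mathcal{Q}_\alpha}$, the algorithm Exp3.$\alpha$ with parameter $\eta$ satisfies $$\mathbb{E}\, R_{Exp3.\alpha,T} \leq \sqrt{\mathcal{Q}_\alpha \log N}.$$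
   Context: Notation: for $\mathbf{x}\in\mathbb{R}^N$, $d(\mathbf{x})=\max_i\{x_i\}-\min_i\{x_i\}$; for vectors $\mathbf{x}_1,\ldots,\mathbf{x}_T\in\mathbb{R}^N$, $q(\mathbf{x}_{1:T})=\sum_{t=1}^T d(\mathbf{x}_t)^2$; $\log$ is the natural logarithm. Model: there are $N$ experts and $T$ rounds. On each round $t$ the learner draws an expert $I_t$ from a distribution $\mathbf{p}_t$ on $\{1,\ldots,N\}$ (conditionally on the past), incurs loss $l_{I_t,t}$, and observes $l_{I_t,t}$ and all of $\alpha_{1,t},\ldots,\alpha_{N,t}$. Exp3.$\alpha$ with parameter $\eta>0$: $\mathbf{p}_1$ is uniform and $\widetilde{L}_{i,0}=0$ for all $i$. On each round $t=1,\ldots,T$: draw $I_t\sim\mathbf{p}_t$; set $\widetilde{l}_{i,t} = \frac{l_{i,t}-\alpha_{i,t}}{p_{i,t}}\mathbb{I}\{I_t=i\}+\alpha_{i,t}$ and $\widetilde{L}_{i,t}=\widetilde{L}_{i,t-1}+\widetilde{l}_{i,t}$ for every $i$; set $p_{i,t+1}=\exp(-\eta \widetilde{L}_{i,t})/\sum_{k=1}^N\exp(-\eta\widetilde{L}_{k,t})$. The regret is $R_{Exp3.\alpha,T}=\sum_{t=1}^T l_{I_t,t}-\min_j\sum_{t=1}^T l_{j,t}$. *)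

theory Defs
  imports "HOL-Probability.Probability"
begin

text \<open>
  Experts are \<open>{1..N}\<close> and rounds are \<open>{1..T}\<close>.  A vector in \<open>\<real>\<^sup>N\<close> is a function on \<open>nat\<close>
  of which only the values on \<open>{1..N}\<close> are used; \<open>l i t\<close> and \<open>\<alpha> i t\<close> belong to
  expert \<open>i\<close> and round \<open>t\<close>.
\<close>

definition vec_range :: "nat \<Rightarrow> (nat \<Rightarrow> real) \<Rightarrow> real" where
  "vec_range N x = Max (x ` {1..N}) - Min (x ` {1..N})"

definition quad_range :: "nat \<Rightarrow> nat \<Rightarrow> (nat \<Rightarrow> nat \<Rightarrow> real) \<Rightarrow> real" where
  "quad_range N T x = (\<Sum>t=1..T. (vec_range N (x t))\<^sup>2)"

definition exp_weights :: "nat \<Rightarrow> real \<Rightarrow> (nat \<Rightarrow> real) \<Rightarrow> nat \<Rightarrow> real" where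
  "exp_weights N \<eta> L i = exp (- \<eta> * L i) / (\<Sum>k=1..N. exp (- \<eta> * L k))"

definition loss_estimate ::
  "(nat \<Rightarrow> nat \<Rightarrow> real) \<Rightarrow> (nat \<Rightarrow> nat \<Rightarrow> real) \<Rightarrow> (nat \<Rightarrow> real) \<Rightarrow> nat \<Rightarrow> nat \<Rightarrow> nat \<Rightarrow> real" where
  "loss_estimate l \<alpha> p I\<^sub>t t i = (l i t - \<alpha> i t) / p i * of_bool (I\<^sub>t = i) + \<alpha> i t"

text \<open>
  \<open>I t\<close> is the expert drawn on round \<open>t\<close>.  The estimates after round \<open>t\<close> depend only on
  \<open>I 1, \<dots>, I t\<close>, and the sampling distribution of round \<open>t\<close> only on \<open>I 1, \<dots>, I (t - 1)\<close>.
\<close>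

primrec cum_estimate ::
  "nat \<Rightarrow> real \<Rightarrow> (nat \<Rightarrow> nat \<Rightarrow> real) \<Rightarrow> (nat \<Rightarrow> nat \<Rightarrow> real) \<Rightarrow> (nat \<Rightarrow> nat) \<Rightarrow> nat \<Rightarrow> nat \<Rightarrow> real" where
  "cum_estimate N \<eta> l \<alpha> I 0 = (\<lambda>i. 0)"
| "cum_estimate N \<eta> l \<alpha> I (Suc t) = (\<lambda>i. cum_estimate N \<eta> l \<alpha> I t i +
     loss_estimate l \<alpha> (exp_weights N \<eta> (cum_estimate N \<eta> l \<alpha> I t)) (I (Suc t)) (Suc t) i)"

definition exp3_prob ::
  "nat \<Rightarrow> real \<Rightarrow> (nat \<Rightarrow> nat \<Rightarrow> real) \<Rightarrow> (nat \<Rightarrow> nat \<Rightarrow> real) \<Rightarrow> (nat \<Rightarrow> nat) \<Rightarrow> nat \<Rightarrow> nat \<Rightarrow> real" where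
  "exp3_prob N \<eta> l \<alpha> I t = exp_weights N \<eta> (cum_estimate N \<eta> l \<alpha> I (t - 1))"

definition expert_pmf :: "nat \<Rightarrow> (nat \<Rightarrow> real) \<Rightarrow> nat pmf" where
  "expert_pmf N p = embed_pmf (\<lambda>i. if i \<in> {1..N} then p i else 0)"

text \<open>
  Joint law of the draws of the first \<open>t\<close> rounds, as a distribution on functions whose values
  outside \<open>{1..t}\<close> are \<open>undefined\<close>.
\<close>

primrec exp3_draws ::
  "nat \<Rightarrow> real \<Rightarrow> (nat \<Rightarrow> nat \<Rightarrow> real) \<Rightarrow> (nat \<Rightarrow> nat \<Rightarrow> real) \<Rightarrow> nat \<Rightarrow> (nat \<Rightarrow> nat) pmf" where
  "exp3_draws N \<eta> l \<alpha> 0 = return_pmf (\<lambda>_. undefined)"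
| "exp3_draws N \<eta> l \<alpha> (Suc t) = bind_pmf (exp3_draws N \<eta> l \<alpha> t) (\<lambda>I.
     map_pmf (\<lambda>i. I(Suc t := i)) (expert_pmf N (exp3_prob N \<eta> l \<alpha> I (Suc t))))"

definition regret :: "nat \<Rightarrow> nat \<Rightarrow> (nat \<Rightarrow> nat \<Rightarrow> real) \<Rightarrow> (nat \<Rightarrow> nat) \<Rightarrow> real" where
  "regret N T l I = (\<Sum>t=1..T. l (I t) t) - Min ((\<lambda>j. \<Sum>t=1..T. l j t) ` {1..N})"

lemma exp3_prob_first: "exp3_prob N \<eta> l \<alpha> I 1 i = 1 / real N"
  by (simp add: exp3_prob_def exp_weights_def)

lemma exp3_prob_Suc:
  "exp3_prob N \<eta> l \<alpha> I (Suc t) i = exp (- \<eta> * cum_estimate N \<eta> l \<alpha> I t i) /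
     (\<Sum>k=1..N. exp (- \<eta> * cum_estimate N \<eta> l \<alpha> I t k))"
  by (simp add: exp3_prob_def exp_weights_def)

lemma exp_weights_nonneg: "exp_weights N \<eta> L i \<ge> 0"
  by (simp add: exp_weights_def sum_nonneg)

lemma sum_exp_weights:
  assumes "N \<ge> 1"
  shows "(\<Sum>i=1..N. exp_weights N \<eta> L i) = 1"
proof -
  have "(\<Sum>k=1..N. exp (- \<eta> * L k)) > 0"
    using assms by (intro sum_pos) auto
  then show ?thesis
    by (simp add: exp_weights_def flip: sum_divide_distrib)
qed

lemma pmf_expert_pmf:
  assumes "\<And>i. i \<in> {1..N} \<Longrightarrow> p i \<ge> 0" and "(\<Sum>i=1..N. p i) = 1"
  shows "pmf (expert_pmf N p) i = (if i \<in> {1..N} then p i else 0)"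
  unfolding expert_pmf_def
proof (rule pmf_embed_pmf)
  let ?f = "\<lambda>i. if i \<in> {1..N} then p i else 0"
  show "?f i \<ge> 0" for i using assms(1) by simp
  have "(\<integral>\<^sup>+ i. ennreal (?f i) \<partial>count_space UNIV) = (\<Sum>i\<in>{1..N}. ennreal (?f i))"
    by (intro nn_integral_count_space') auto
  also have "\<dots> = ennreal (\<Sum>i=1..N. p i)"
    using assms(1) by (intro trans[OF _ sum_ennreal] sum.cong) auto
  finally show "(\<integral>\<^sup>+ i. ennreal (?f i) \<partial>count_space UNIV) = 1"
    using assms(2) by simp
qed

lemma pmf_expert_exp3_prob:
  assumes "N \<ge> 1"
  shows "pmf (expert_pmf N (exp3_prob N \<eta> l \<alpha> I t)) i =
    (if i \<in> {1..N} then exp3_prob N \<eta> l \<alpha> I t i else 0)"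
  unfolding exp3_prob_def
  by (intro pmf_expert_pmf exp_weights_nonneg sum_exp_weights assms)

end

theory Submission imports Defs begin

text \<open>
  Let \<open>V t = (\<Sum>k. exp (- \<eta> * L k t))\<close> for the estimated cumulative losses \<open>L\<close>.  The expectation of
  the potential \<open>(\<Sum>s\<le>t. l (I s) s) + ln (V t) / \<eta>\<close> starts at \<open>ln N / \<eta>\<close> and grows in each round by
  at most the expected mixability gap.  The \<open>\<alpha>\<close>-part of this gap is controlled by Hoeffding's lemma
  and the importance-weighted part, which only affects the drawn expert, by linearising \<open>ln\<close>.  On the
  other hand \<open>ln (V T) / \<eta> \<ge> - L j T\<close> for every \<open>j\<close>, and \<open>L j T\<close> is unbiased.
\<close>

section \<open>Elementary inequalities for \<open>exp\<close>, \<open>ln\<close> and ranges\<close>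

text \<open>The right-hand side times \<open>1 + y + y\<^sup>2 / 2\<close> is
  \<open>1 + (y\<^sup>2)\<^sup>2 / 4\<close>, hence at least 1. For nonnegative \<open>y\<close> the
  second factor is at most \<open>exp y\<close>, so the product of the right-hand side with
  \<open>exp y\<close> is at least 1 as well.\<close>

lemma exp_minus_le_quadratic:
  fixes y :: real
  assumes "y \<ge> 0"
  shows "exp (- y) \<le> 1 - y + y\<^sup>2 / 2"
proof -
  \<comment> \<open>The quadratic equals \<open>((1 - y)\<^sup>2 + 1) / 2\<close>.\<close>
  have pos: "1 - y + y\<^sup>2 / 2 > 0"
    using sum_power2_gt_zero_iff[of "1 - y" 1] by (simp add: power2_eq_square field_simps)
  have "(1 - y + y\<^sup>2 / 2) * (1 + y + y\<^sup>2 / 2) = 1 + (y\<^sup>2)\<^sup>2 / 4"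
    by (simp add: power2_eq_square field_simps)
  then have "1 \<le> (1 - y + y\<^sup>2 / 2) * (1 + y + y\<^sup>2 / 2)"
    by simp
  also have "\<dots> \<le> (1 - y + y\<^sup>2 / 2) * exp y"
    using pos exp_lower_Taylor_quadratic[OF assms] by (intro mult_left_mono) auto
  finally show ?thesis
    by (simp add: exp_minus field_simps)
qed

text \<open>Concavity: \<open>ln\<close> lies below its tangent at \<open>S\<close>.\<close>

lemma ln_add_le:
  fixes S x :: real
  assumes "S > 0" and "S + x > 0"
  shows "ln (S + x) \<le> ln S + x / S"
proof -
  have "ln (S + x) - ln S = ln ((S + x) / S)"
    using assms by (simp add: ln_div)
  also have "\<dots> \<le> (S + x) / S - 1"
    using assms by (intro ln_le_minus_one) auto
  finally show ?thesis using assms by (simp add: field_simps)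
qed

lemma Max_diff_Min_image_le:
  fixes f :: "'a \<Rightarrow> real"
  assumes "finite A" and "i \<in> A" and "k \<in> A"
  shows "f i - f k \<le> Max (f ` A) - Min (f ` A)"
  using assms by (intro diff_mono Max_ge Min_le) auto

section \<open>A single draw: expectations, Hoeffding's bound and the gap of one round\<close>

lemma expectation_expert_pmf:
  fixes f :: "nat \<Rightarrow> real"
  assumes "\<And>i. i \<in> {1..N} \<Longrightarrow> p i \<ge> 0" and "(\<Sum>i=1..N. p i) = 1"
  shows "measure_pmf.expectation (expert_pmf N p) f = (\<Sum>i=1..N. p i * f i)"
proof -
  have pmf: "pmf (expert_pmf N p) i = (if i \<in> {1..N} then p i else 0)" for i
    using assms by (rule pmf_expert_pmf)
  have "measure_pmf.expectation (expert_pmf N p) f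
      = (\<Sum>i\<in>{1..N}. f i * pmf (expert_pmf N p) i)"
    by (intro integral_measure_pmf_real) (auto simp: set_pmf_eq pmf split: if_splits)
  then show ?thesis
    by (simp add: pmf mult.commute)
qed

lemma set_expert_pmf_subset:
  assumes "\<And>i. i \<in> {1..N} \<Longrightarrow> p i \<ge> 0" and "(\<Sum>i=1..N. p i) = 1"
  shows "set_pmf (expert_pmf N p) \<subseteq> {1..N}"
proof -
  have "pmf (expert_pmf N p) i = (if i \<in> {1..N} then p i else 0)" for i
    using assms by (rule pmf_expert_pmf)
  then show ?thesis
    by (auto simp: set_pmf_eq split: if_splits)
qed

text \<open>The left side is the logarithmic moment generating function of \<open>- a\<close> under
  \<open>p\<close>, and the values of \<open>- a\<close> lie in an interval of length
  \<open>vec_range N a\<close>.\<close>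

lemma Hoeffdings_lemma_ln_sum:
  fixes p a :: "nat \<Rightarrow> real"
  assumes p: "\<And>i. i \<in> {1..N} \<Longrightarrow> p i \<ge> 0" "(\<Sum>i=1..N. p i) = 1"
    and "\<eta> > 0" and pos: "(\<Sum>k=1..N. p k * exp (- \<eta> * a k)) > 0"
  shows "ln (\<Sum>k=1..N. p k * exp (- \<eta> * a k))
    \<le> - \<eta> * (\<Sum>k=1..N. p k * a k) + \<eta>\<^sup>2 * (vec_range N a)\<^sup>2 / 8"
proof -
  define M where "M = expert_pmf N p"
  define \<mu> where "\<mu> = (\<Sum>k=1..N. p k * a k)"
  have sub: "set_pmf M \<subseteq> {1..N}" unfolding M_def by (rule set_expert_pmf_subset[OF p])
  interpret interval_bounded_random_variable M "\<lambda>i. - a i" "- Max (a ` {1..N})" "- Min (a ` {1..N})"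
    using sub by unfold_locales (auto simp: AE_measure_pmf_iff)
  have fin: "finite (set_pmf M)" using sub finite_subset by blast
  have E: "measure_pmf.expectation M f = (\<Sum>i=1..N. p i * f i)" for f
    unfolding M_def by (rule expectation_expert_pmf[OF p])
  \<comment> \<open>Hoeffding's lemma speaks of the centred variable: \<open>- a\<close> has mean
    \<open>- \<mu>\<close>, so centring adds \<open>\<mu>\<close>. The extra factor
    \<open>exp (\<eta> * \<mu>)\<close> becomes the linear term once logarithms are taken.\<close>
  have "(\<integral>\<^sup>+ x. exp (\<eta> * (- a x + \<mu>)) \<partial>M) \<le> ennreal (exp (\<eta>\<^sup>2 * (vec_range N a)\<^sup>2 / 8))"
    using Hoeffdings_lemma_nn_integral[OF \<open>\<eta> > 0\<close>]
    by (simp add: E \<mu>_def vec_range_def sum_negf)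
  then have "ennreal (measure_pmf.expectation M (\<lambda>x. exp (\<eta> * (- a x + \<mu>))))
      \<le> ennreal (exp (\<eta>\<^sup>2 * (vec_range N a)\<^sup>2 / 8))"
    by (subst (asm) nn_integral_eq_integral) (auto intro: integrable_measure_pmf_finite[OF fin])
  then have "measure_pmf.expectation M (\<lambda>x. exp (\<eta> * (- a x + \<mu>)))
      \<le> exp (\<eta>\<^sup>2 * (vec_range N a)\<^sup>2 / 8)"
    by simp
  also have "measure_pmf.expectation M (\<lambda>x. exp (\<eta> * (- a x + \<mu>)))
      = (\<Sum>k=1..N. p k * exp (- \<eta> * a k)) * exp (\<eta> * \<mu>)"
    unfolding E sum_distrib_right
    by (intro sum.cong) (auto simp: ring_distribs mult.assoc simp flip: exp_add)
  finally have "ln ((\<Sum>k=1..N. p k * exp (- \<eta> * a k)) * exp (\<eta> * \<mu>))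
      \<le> \<eta>\<^sup>2 * (vec_range N a)\<^sup>2 / 8"
    using pos ln_mono[of "(\<Sum>k=1..N. p k * exp (- \<eta> * a k)) * exp (\<eta> * \<mu>)"
        "exp (\<eta>\<^sup>2 * (vec_range N a)\<^sup>2 / 8)"] by simp
  then show ?thesis
    using pos by (simp add: ln_mult \<mu>_def)
qed

text \<open>
  With \<open>w i = exp (- \<eta> * a i) / S\<close>, the exponential correction term caused by drawing \<open>i\<close> is
  \<open>w i * (exp (- \<eta> * c i / p i) - 1)\<close>.  For \<open>w i \<ge> 1\<close> the factor \<open>w i\<close> may be dropped because the
  bracket is nonpositive; for \<open>w i < 1\<close> one uses \<open>1 - w i \<le> \<eta> * vec_range N a\<close>.
\<close>
lemma expected_mixability_gap_le:
  fixes p a c :: "nat \<Rightarrow> real"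
  assumes p: "\<And>i. i \<in> {1..N} \<Longrightarrow> p i > 0" "(\<Sum>i=1..N. p i) = 1"
    and c: "\<And>i. i \<in> {1..N} \<Longrightarrow> c i \<ge> 0" and \<eta>: "\<eta> > 0"
  shows "(\<Sum>i=1..N. p i * (a i + c i
      + ln (\<Sum>k=1..N. p k * exp (- \<eta> * (c k / p k * of_bool (i = k) + a k))) / \<eta>))
    \<le> \<eta> * ((vec_range N a)\<^sup>2 / 8 + (\<Sum>i=1..N. (c i)\<^sup>2) / 2 + Max (c ` {1..N}) * vec_range N a)"
proof -
  define S where "S = (\<Sum>k=1..N. p k * exp (- \<eta> * a k))"
  define d where "d = vec_range N a"
  define m where "m = (\<Sum>k=1..N. p k * a k)"
  define C where "C = Max (c ` {1..N})"
  have ne: "{1..N} \<noteq> {}" using p(2) by (cases "N = 0") auto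
  have S: "S > 0" unfolding S_def using p ne by (intro sum_pos) auto
  have d_ge: "a i - a k \<le> d" if "i \<in> {1..N}" "k \<in> {1..N}" for i k
    unfolding d_def vec_range_def using that by (intro Max_diff_Min_image_le) auto
  have d: "d \<ge> 0" using d_ge ne by force
  have lnS: "ln S \<le> - \<eta> * m + \<eta>\<^sup>2 * d\<^sup>2 / 8"
    unfolding S_def m_def d_def using p \<eta> S
    by (intro Hoeffdings_lemma_ln_sum) (auto simp: S_def less_imp_le)
  have round: "c i + ln (\<Sum>k=1..N. p k * exp (- \<eta> * (c k / p k * of_bool (i = k) + a k))) / \<eta>
      \<le> - m + \<eta> * d\<^sup>2 / 8 + C * \<eta> * d + \<eta> * (c i)\<^sup>2 / (2 * p i)"
    if i: "i \<in> {1..N}" for i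
  proof -
    define w where "w = exp (- \<eta> * a i) / S"
    define y where "y = \<eta> * c i / p i"
    have pi: "p i > 0" and ci: "c i \<ge> 0" using p c i by auto
    have y: "y \<ge> 0" using pi ci \<eta> by (simp add: y_def)
    have w0: "w > 0" using S by (simp add: w_def)
    let ?R = "\<Sum>k=1..N. p k * exp (- \<eta> * (c k / p k * of_bool (i = k) + a k))"
    have Rpos: "?R > 0" using p ne by (intro sum_pos) auto
    \<comment> \<open>Only the summand \<open>k = i\<close> feels the draw of \<open>i\<close>, so
      \<open>?R\<close> is a perturbation of the draw-independent sum \<open>S\<close>.\<close>
    have "?R = (\<Sum>k=1..N. p k * exp (- \<eta> * a k)
        + (if k = i then p i * exp (- \<eta> * a i) * (exp (- y) - 1) else 0))"
      by (intro sum.cong) (auto simp: y_def algebra_simps simp flip: exp_add)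
    also have "\<dots> = S + p i * exp (- \<eta> * a i) * (exp (- y) - 1)"
      using i by (simp add: sum.distrib S_def)
    finally have R: "?R = S + p i * exp (- \<eta> * a i) * (exp (- y) - 1)" .
    have "ln ?R \<le> ln S + p i * (w * (exp (- y) - 1))"
      using ln_add_le[of S "p i * exp (- \<eta> * a i) * (exp (- y) - 1)"] S Rpos
      unfolding R w_def by simp
    moreover have "w * (exp (- y) - 1) \<le> - y + \<eta> * d * y + y\<^sup>2 / 2"
    proof (cases "w \<ge> 1")
      case True
      have "w * (exp (- y) - 1) \<le> 1 * (exp (- y) - 1)"
        using True y by (intro mult_right_mono_neg) auto
      also have "\<dots> \<le> - y + y\<^sup>2 / 2"
        using exp_minus_le_quadratic[OF y] by simp
      also have "\<dots> \<le> - y + \<eta> * d * y + y\<^sup>2 / 2"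
        using \<eta> d y by simp
      finally show ?thesis .
    next
      case False
      \<comment> \<open>Every \<open>a k\<close> is at least \<open>a i - d\<close> and the weights
        sum to one. This bounds \<open>w\<close> below by \<open>exp (- (\<eta> * d))\<close>, and
        thus by \<open>1 - \<eta> * d\<close>.\<close>
      have "S \<le> (\<Sum>k=1..N. p k * exp (\<eta> * d - \<eta> * a i))"
        unfolding S_def
      proof (intro sum_mono mult_left_mono)
        fix k assume k: "k \<in> {1..N}"
        show "p k \<ge> 0" using p(1)[OF k] by simp
        have "\<eta> * (a i - a k) \<le> \<eta> * d" using d_ge[OF i k] \<eta> by simp
        then show "exp (- \<eta> * a k) \<le> exp (\<eta> * d - \<eta> * a i)" by (simp add: algebra_simps)
      qed
      also have "\<dots> = exp (\<eta> * d - \<eta> * a i)" by (simp only: p(2) mult_1 flip: sum_distrib_right)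
      finally have "w \<ge> exp (- \<eta> * a i) / exp (\<eta> * d - \<eta> * a i)"
        unfolding w_def using S by (intro divide_left_mono) auto
      then have "w \<ge> exp (- (\<eta> * d))"
        by (simp flip: exp_diff)
      then have w: "w \<ge> 1 - \<eta> * d" using exp_ge_add_one_self[of "- (\<eta> * d)"] by simp
      have "w * (exp (- y) - 1) \<le> w * (- y + y\<^sup>2 / 2)"
        using exp_minus_le_quadratic[OF y] w0 by (intro mult_left_mono) auto
      also have "\<dots> = - (w * y) + w * (y\<^sup>2 / 2)" by (simp add: algebra_simps)
      also have "\<dots> \<le> - ((1 - \<eta> * d) * y) + 1 * (y\<^sup>2 / 2)"
        using w y False by (intro add_mono mult_right_mono le_imp_neg_le) auto
      finally show ?thesis by (simp add: algebra_simps)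
    qed
    ultimately have "ln ?R \<le> (- \<eta> * m + \<eta>\<^sup>2 * d\<^sup>2 / 8) + p i * (- y + \<eta> * d * y + y\<^sup>2 / 2)"
      using lnS pi by (smt (verit) mult_left_mono)
    then have "ln ?R / \<eta> \<le> ((- \<eta> * m + \<eta>\<^sup>2 * d\<^sup>2 / 8) + p i * (- y + \<eta> * d * y + y\<^sup>2 / 2)) / \<eta>"
      using \<eta> by (intro divide_right_mono) auto
    \<comment> \<open>Here \<open>p i * y / \<eta> = c i\<close>, and the resulting
      \<open>- c i\<close> cancels the \<open>c i\<close> on the left of \<open>round\<close>. The
      quadratic term keeps a factor \<open>1 / p i\<close>.\<close>
    also have "\<dots> = - m + \<eta> * d\<^sup>2 / 8 - c i + c i * (\<eta> * d) + \<eta> * (c i)\<^sup>2 / (2 * p i)"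
      using \<eta> pi by (simp add: y_def field_simps power2_eq_square)
    also have "c i * (\<eta> * d) \<le> C * (\<eta> * d)"
      unfolding C_def using i \<eta> d by (intro mult_right_mono Max_ge) auto
    finally show ?thesis by simp
  qed
  have "(\<Sum>i=1..N. p i * (a i + c i
      + ln (\<Sum>k=1..N. p k * exp (- \<eta> * (c k / p k * of_bool (i = k) + a k))) / \<eta>))
    \<le> (\<Sum>i=1..N. p i * (a i + (- m + \<eta> * d\<^sup>2 / 8 + C * \<eta> * d + \<eta> * (c i)\<^sup>2 / (2 * p i))))"
    using round p(1) by (intro sum_mono mult_left_mono) (auto simp: add.assoc less_imp_le)
  \<comment> \<open>Averaging over the draw cancels the remaining \<open>1 / p i\<close>, so the
    bound does not deteriorate when probabilities are small.\<close>
  also have "\<dots> = (\<Sum>i=1..N. p i * a i + p i * (- m + \<eta> * d\<^sup>2 / 8 + C * \<eta> * d) + \<eta> / 2 * (c i)\<^sup>2)"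
  proof (intro sum.cong refl)
    fix i assume "i \<in> {1..N}"
    then have "p i \<noteq> 0" using p(1) by force
    then show "p i * (a i + (- m + \<eta> * d\<^sup>2 / 8 + C * \<eta> * d + \<eta> * (c i)\<^sup>2 / (2 * p i)))
      = p i * a i + p i * (- m + \<eta> * d\<^sup>2 / 8 + C * \<eta> * d) + \<eta> / 2 * (c i)\<^sup>2"
      by (simp add: field_simps)
  qed
  also have "\<dots> = m + (- m + \<eta> * d\<^sup>2 / 8 + C * \<eta> * d) + \<eta> / 2 * (\<Sum>i=1..N. (c i)\<^sup>2)"
    using p(2) by (simp only: sum.distrib m_def mult_1 flip: sum_distrib_right sum_distrib_left)
  finally show ?thesis
    unfolding C_def d_def by (simp add: algebra_simps)
qed

section \<open>The law of the draws and unbiasedness of the estimates\<close>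

lemma exp_weights_pos: "N \<ge> 1 \<Longrightarrow> exp_weights N \<eta> L i > 0"
  unfolding exp_weights_def by (intro divide_pos_pos sum_pos) auto

lemma set_pmf_expert_exp3_prob:
  assumes "N \<ge> 1"
  shows "set_pmf (expert_pmf N (exp3_prob N \<eta> l \<alpha> I t)) \<subseteq> {1..N}"
  unfolding exp3_prob_def
  by (intro set_expert_pmf_subset exp_weights_nonneg sum_exp_weights assms)

text \<open>Finite support makes every real function of the draws integrable, which justifies
  linearity and monotonicity of the expectations below.\<close>

lemma finite_exp3_draws:
  assumes "N \<ge> 1"
  shows "finite (set_pmf (exp3_draws N \<eta> l \<alpha> t))"
proof (induction t)
  case (Suc t)
  have "finite (set_pmf (expert_pmf N (exp3_prob N \<eta> l \<alpha> I (Suc t))))" for I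
    using set_pmf_expert_exp3_prob[OF assms] by (rule finite_subset) auto
  with Suc show ?case by auto
qed auto

text \<open>The tower rule: the inner sum is the conditional expectation over round
  \<open>Suc t\<close> given the first \<open>t\<close> draws.\<close>

lemma expectation_exp3_draws_Suc:
  fixes f :: "(nat \<Rightarrow> nat) \<Rightarrow> real"
  assumes "N \<ge> 1"
  shows "measure_pmf.expectation (exp3_draws N \<eta> l \<alpha> (Suc t)) f
    = measure_pmf.expectation (exp3_draws N \<eta> l \<alpha> t)
        (\<lambda>I. \<Sum>i=1..N. exp_weights N \<eta> (cum_estimate N \<eta> l \<alpha> I t) i * f (I(Suc t := i)))"
proof -
  have f: "finite (set_pmf (expert_pmf N (exp3_prob N \<eta> l \<alpha> I (Suc t))))" for I
    using set_pmf_expert_exp3_prob[OF assms] by (rule finite_subset) auto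
  have *: "measure_pmf.expectation (map_pmf (\<lambda>i. I(Suc t := i))
        (expert_pmf N (exp3_prob N \<eta> l \<alpha> I (Suc t)))) f
      = (\<Sum>i=1..N. exp_weights N \<eta> (cum_estimate N \<eta> l \<alpha> I t) i * f (I(Suc t := i)))" for I
    unfolding integral_map_pmf exp3_prob_def diff_Suc_1
    by (intro expectation_expert_pmf exp_weights_nonneg sum_exp_weights assms)
  show ?thesis
    unfolding exp3_draws.simps *[symmetric]
    by (subst pmf_expectation_bind[OF finite_exp3_draws[OF assms, of \<eta> l \<alpha> t]])
      (auto simp: f integral_measure_pmf[OF finite_exp3_draws[OF assms, of \<eta> l \<alpha> t]])
qed

lemma cum_estimate_cong:
  assumes "\<And>s. s \<in> {1..t} \<Longrightarrow> I s = J s"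
  shows "cum_estimate N \<eta> l \<alpha> I t = cum_estimate N \<eta> l \<alpha> J t"
  using assms by (induction t) auto

text \<open>A rewrite rule for inductions over rounds, where the tower rule evaluates everything at
  the extended history \<open>I(Suc t := i)\<close>.\<close>

lemma cum_estimate_update [simp]:
  "cum_estimate N \<eta> l \<alpha> (I(Suc t := i)) t = cum_estimate N \<eta> l \<alpha> I t"
  by (intro cum_estimate_cong) auto

lemma sum_loss_update [simp]:
  "(\<Sum>s=1..t. l ((I(Suc t := i)) s) s) = (\<Sum>s=1..t. l (I s) s)"
  by (intro sum.cong) auto

text \<open>The importance weight \<open>1 / p j\<close> occurs only in the summand
  \<open>i = j\<close>, where the sampling probability cancels it; the offset
  \<open>\<alpha> j t\<close> is collected with total weight one.\<close>

lemma expectation_loss_estimate: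
  assumes "j \<in> {1..N}" and "p j \<noteq> 0" and "(\<Sum>i=1..N. p i) = 1"
  shows "(\<Sum>i=1..N. p i * loss_estimate l \<alpha> p i t j) = l j t"
proof -
  have "(\<Sum>i=1..N. p i * loss_estimate l \<alpha> p i t j)
      = (\<Sum>i=1..N. (if i = j then l j t - \<alpha> j t else 0) + p i * \<alpha> j t)"
    using assms(2) by (intro sum.cong) (auto simp: loss_estimate_def field_simps)
  then show ?thesis
    using assms by (simp add: sum.distrib flip: sum_distrib_right)
qed

text \<open>By the tower rule each round contributes its true loss, because exponential weights are
  positive and the one-round estimate is therefore unbiased.\<close>

lemma expectation_cum_estimate:
  assumes "j \<in> {1..N}"
  shows "measure_pmf.expectation (exp3_draws N \<eta> l \<alpha> t) (\<lambda>I. cum_estimate N \<eta> l \<alpha> I t j)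
    = (\<Sum>s=1..t. l j s)"
proof (induction t)
  case (Suc t)
  have N: "N \<ge> 1" using assms by simp
  have "(\<Sum>i=1..N. exp_weights N \<eta> (cum_estimate N \<eta> l \<alpha> I t) i *
      cum_estimate N \<eta> l \<alpha> (I(Suc t := i)) (Suc t) j) = cum_estimate N \<eta> l \<alpha> I t j + l j (Suc t)" for I
    using assms exp_weights_pos[OF N, of \<eta> "cum_estimate N \<eta> l \<alpha> I t" j]
    by (simp add: ring_distribs sum.distrib expectation_loss_estimate sum_exp_weights[OF N]
        del: One_nat_def flip: sum_distrib_right)
  then show ?case
    using Suc N finite_exp3_draws[OF N, of \<eta> l \<alpha> t]
    by (simp add: expectation_exp3_draws_Suc integrable_measure_pmf_finite del: exp3_draws.simps cum_estimate.simps)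
qed simp

section \<open>Growth of the potential\<close>

text \<open>Since \<open>p I t k\<close> is the share of expert \<open>k\<close> in the old sum, the
  ratio of the new sum to the old one is the \<open>p I t\<close>-average of the exponentials of the
  new estimates.\<close>

lemma ln_sum_exp_cum_estimate_Suc:
  fixes l \<alpha> :: "nat \<Rightarrow> nat \<Rightarrow> real" and \<eta> :: real
  assumes "N \<ge> 1"
  defines "p \<equiv> \<lambda>I t. exp_weights N \<eta> (cum_estimate N \<eta> l \<alpha> I t)"
  shows "ln (\<Sum>k=1..N. exp (- \<eta> * cum_estimate N \<eta> l \<alpha> I (Suc t) k))
    = ln (\<Sum>k=1..N. exp (- \<eta> * cum_estimate N \<eta> l \<alpha> I t k))
      + ln (\<Sum>k=1..N. p I t k * exp (- \<eta> * loss_estimate l \<alpha> (p I t) (I (Suc t)) (Suc t) k))"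
proof -
  define V where "V = (\<Sum>k=1..N. exp (- \<eta> * cum_estimate N \<eta> l \<alpha> I t k))"
  have V: "V > 0" unfolding V_def using assms by (intro sum_pos) auto
  have "(\<Sum>k=1..N. exp (- \<eta> * cum_estimate N \<eta> l \<alpha> I (Suc t) k))
      = V * (\<Sum>k=1..N. p I t k * exp (- \<eta> * loss_estimate l \<alpha> (p I t) (I (Suc t)) (Suc t) k))"
    unfolding sum_distrib_left
  proof (intro sum.cong refl)
    fix k
    have "V * p I t k = exp (- \<eta> * cum_estimate N \<eta> l \<alpha> I t k)"
      using V unfolding p_def exp_weights_def V_def[symmetric] by simp
    then show "exp (- \<eta> * cum_estimate N \<eta> l \<alpha> I (Suc t) k)
      = V * (p I t k * exp (- \<eta> * loss_estimate l \<alpha> (p I t) (I (Suc t)) (Suc t) k))"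
      by (simp add: p_def ring_distribs mult.assoc[symmetric] flip: exp_add)
  qed
  moreover have "(\<Sum>k=1..N. p I t k * exp (- \<eta> * loss_estimate l \<alpha> (p I t) (I (Suc t)) (Suc t) k)) > 0"
    unfolding p_def using assms by (intro sum_pos mult_pos_pos exp_weights_pos) auto
  ultimately show ?thesis using V by (simp only: ln_mult_pos V_def[symmetric])
qed

text \<open>A quarter of what one round contributes to the quantity bounded by \<open>Q\<close>.
  Multiplied by \<open>\<eta>\<close>, it is the bound of \<open>expected_mixability_gap_le\<close>
  with \<open>a\<close> the offsets \<open>\<alpha>\<close> and \<open>c\<close> the differences of
  \<open>l\<close> and \<open>\<alpha>\<close>.\<close>

definition round_bound ::
  "nat \<Rightarrow> (nat \<Rightarrow> nat \<Rightarrow> real) \<Rightarrow> (nat \<Rightarrow> nat \<Rightarrow> real) \<Rightarrow> nat \<Rightarrow> real" where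
  "round_bound N l \<alpha> t = (vec_range N (\<lambda>i. \<alpha> i t))\<^sup>2 / 8 + (\<Sum>i=1..N. (l i t - \<alpha> i t)\<^sup>2) / 2
     + Max ((\<lambda>i. l i t - \<alpha> i t) ` {1..N}) * vec_range N (\<lambda>i. \<alpha> i t)"

lemma expectation_potential_le:
  assumes N: "N \<ge> 1" and \<eta>: "\<eta> > 0"
    and c: "\<And>i s. i \<in> {1..N} \<Longrightarrow> s \<in> {1..t} \<Longrightarrow> l i s - \<alpha> i s \<ge> 0"
  shows "measure_pmf.expectation (exp3_draws N \<eta> l \<alpha> t) (\<lambda>I. (\<Sum>s=1..t. l (I s) s)
      + ln (\<Sum>k=1..N. exp (- \<eta> * cum_estimate N \<eta> l \<alpha> I t k)) / \<eta>)
    \<le> ln (real N) / \<eta> + \<eta> * (\<Sum>s=1..t. round_bound N l \<alpha> s)"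
  using c
proof (induction t)
  case (Suc t)
  let ?V = "\<lambda>I t. \<Sum>k=1..N. exp (- \<eta> * cum_estimate N \<eta> l \<alpha> I t k)"
  let ?\<Phi> = "\<lambda>t I. (\<Sum>s=1..t. l (I s) s) + ln (?V I t) / \<eta>"
  let ?E = "measure_pmf.expectation (exp3_draws N \<eta> l \<alpha> t)"
  have int: "integrable (measure_pmf (exp3_draws N \<eta> l \<alpha> t)) f" for f :: "_ \<Rightarrow> real"
    by (intro integrable_measure_pmf_finite finite_exp3_draws N)
  have step: "(\<Sum>i=1..N. exp_weights N \<eta> (cum_estimate N \<eta> l \<alpha> I t) i * ?\<Phi> (Suc t) (I(Suc t := i)))
      \<le> ?\<Phi> t I + \<eta> * round_bound N l \<alpha> (Suc t)" for I
  proof -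
    define p where "p = exp_weights N \<eta> (cum_estimate N \<eta> l \<alpha> I t)"
    \<comment> \<open>The increment of the potential when \<open>i\<close> is drawn. The loss is
      split into \<open>\<alpha>\<close> and the nonnegative rest to match
      \<open>expected_mixability_gap_le\<close>.\<close>
    define g where "g i = \<alpha> i (Suc t) + (l i (Suc t) - \<alpha> i (Suc t))
      + ln (\<Sum>k=1..N. p k * exp (- \<eta> * loss_estimate l \<alpha> p i (Suc t) k)) / \<eta>" for i
    have "?\<Phi> (Suc t) (I(Suc t := i)) = ?\<Phi> t I + g i" for i
      unfolding ln_sum_exp_cum_estimate_Suc[OF N] g_def p_def
      by (simp add: add_divide_distrib)
    then have "(\<Sum>i=1..N. p i * ?\<Phi> (Suc t) (I(Suc t := i))) = ?\<Phi> t I + (\<Sum>i=1..N. p i * g i)"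
      using sum_exp_weights[OF N, of \<eta> "cum_estimate N \<eta> l \<alpha> I t", folded p_def]
      by (simp only: ring_distribs(1)[of "p _"] sum.distrib sum_distrib_right[symmetric] mult_1)
    also have "(\<Sum>i=1..N. p i * g i) \<le> \<eta> * round_bound N l \<alpha> (Suc t)"
      unfolding g_def loss_estimate_def round_bound_def
      using Suc.prems sum_exp_weights[OF N] \<eta>
      by (intro expected_mixability_gap_le) (auto simp: p_def exp_weights_pos[OF N])
    finally show ?thesis unfolding p_def by simp
  qed
  have "measure_pmf.expectation (exp3_draws N \<eta> l \<alpha> (Suc t)) (?\<Phi> (Suc t))
      \<le> ?E (\<lambda>I. ?\<Phi> t I + \<eta> * round_bound N l \<alpha> (Suc t))"
    unfolding expectation_exp3_draws_Suc[OF N] by (intro integral_mono int step)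
  also have "\<dots> = ?E (?\<Phi> t) + \<eta> * round_bound N l \<alpha> (Suc t)"
    by (subst Bochner_Integration.integral_add[OF int int]) simp
  also have "?E (?\<Phi> t) \<le> ln (real N) / \<eta> + \<eta> * (\<Sum>s=1..t. round_bound N l \<alpha> s)"
    using Suc.prems by (intro Suc.IH) auto
  finally show ?case by (simp add: algebra_simps)
qed simp

section \<open>From the potential to the regret\<close>

lemma expectation_regret_le:
  assumes N: "N \<ge> 1" and \<eta>: "\<eta> > 0"
    and c: "\<And>i t. i \<in> {1..N} \<Longrightarrow> t \<in> {1..T} \<Longrightarrow> l i t - \<alpha> i t \<ge> 0"
  shows "measure_pmf.expectation (exp3_draws N \<eta> l \<alpha> T) (regret N T l)
    \<le> ln (real N) / \<eta> + \<eta> * (\<Sum>t=1..T. round_bound N l \<alpha> t)"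
proof -
  let ?E = "measure_pmf.expectation (exp3_draws N \<eta> l \<alpha> T)"
  let ?V = "\<lambda>I. \<Sum>k=1..N. exp (- \<eta> * cum_estimate N \<eta> l \<alpha> I T k)"
  have int: "integrable (measure_pmf (exp3_draws N \<eta> l \<alpha> T)) f" for f :: "_ \<Rightarrow> real"
    by (intro integrable_measure_pmf_finite finite_exp3_draws N)
  \<comment> \<open>The losses are fixed in advance, so one best expert \<open>j\<close> serves all
    histories and its loss is a constant under the expectation.\<close>
  have "Min ((\<lambda>j. \<Sum>t=1..T. l j t) ` {1..N}) \<in> (\<lambda>j. \<Sum>t=1..T. l j t) ` {1..N}"
    using N by (intro Min_in) auto
  then obtain j where j: "j \<in> {1..N}" "Min ((\<lambda>j. \<Sum>t=1..T. l j t) ` {1..N}) = (\<Sum>t=1..T. l j t)"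
    by auto
  have lb: "- cum_estimate N \<eta> l \<alpha> I T j \<le> ln (?V I) / \<eta>" for I
  proof -
    have "exp (- \<eta> * cum_estimate N \<eta> l \<alpha> I T j) \<le> ?V I"
      using j(1) by (intro member_le_sum) auto
    then have "- \<eta> * cum_estimate N \<eta> l \<alpha> I T j \<le> ln (?V I)"
      by (smt (verit) exp_gt_zero ln_exp ln_mono)
    then show ?thesis using \<eta> by (simp add: field_simps)
  qed
  have "?E (regret N T l) = ?E (\<lambda>I. \<Sum>t=1..T. l (I t) t) - (\<Sum>t=1..T. l j t)"
    unfolding regret_def j(2) by (subst Bochner_Integration.integral_diff[OF int int]) simp
  \<comment> \<open>Unbiasedness trades the true loss of \<open>j\<close> for its estimate, which
    \<open>lb\<close> compares with the potential on every history.\<close>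
  also have "\<dots> = ?E (\<lambda>I. (\<Sum>t=1..T. l (I t) t) - cum_estimate N \<eta> l \<alpha> I T j)"
    by (subst Bochner_Integration.integral_diff[OF int int]) (simp add: expectation_cum_estimate[OF j(1)])
  also have "\<dots> \<le> ?E (\<lambda>I. (\<Sum>t=1..T. l (I t) t) + ln (?V I) / \<eta>)"
    using lb by (intro integral_mono int) (smt (verit))
  also have "\<dots> \<le> ln (real N) / \<eta> + \<eta> * (\<Sum>t=1..T. round_bound N l \<alpha> t)"
    using assms by (intro expectation_potential_le) auto
  finally show ?thesis .
qed

theorem theorem9:
  fixes N T :: nat
    and l \<alpha> :: "nat \<Rightarrow> nat \<Rightarrow> real"
    and Q \<eta> :: real
  assumes "N \<ge> 2" and "T \<ge> 1"
    and "\<And>i t. i \<in> {1..N} \<Longrightarrow> t \<in> {1..T} \<Longrightarrow> l i t - \<alpha> i t \<ge> 0"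
    and "Q > 0"
    and "1 / 2 * quad_range N T (\<lambda>t i. \<alpha> i t)
           + 2 * (\<Sum>t=1..T. \<Sum>i=1..N. (l i t - \<alpha> i t)\<^sup>2)
           + 4 * (\<Sum>t=1..T. Max ((\<lambda>i. l i t - \<alpha> i t) ` {1..N}) * vec_range N (\<lambda>i. \<alpha> i t))
         \<le> Q"
    and "\<eta> = sqrt (4 * ln (real N) / Q)"
  shows "measure_pmf.expectation (exp3_draws N \<eta> l \<alpha> T) (regret N T l) \<le> sqrt (Q * ln (real N))"
proof -
  have lnN: "ln (real N) > 0" using assms(1) by simp
  have \<eta>: "\<eta> > 0" using lnN assms(4,6) by simp
  \<comment> \<open>The factor 4 turns the coefficients 1/8, 1/2 and 1 of \<open>round_bound\<close>
    into 1/2, 2 and 4.\<close>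
  have "4 * (\<Sum>t=1..T. round_bound N l \<alpha> t) \<le> Q"
    using assms(5) unfolding round_bound_def quad_range_def
    by (simp add: sum.distrib sum_distrib_left[symmetric] sum_divide_distrib[symmetric])
  then have b: "\<eta> * (\<Sum>t=1..T. round_bound N l \<alpha> t) \<le> \<eta> * (Q / 4)"
    using \<eta> by (intro mult_left_mono) auto
  have "measure_pmf.expectation (exp3_draws N \<eta> l \<alpha> T) (regret N T l)
      \<le> ln (real N) / \<eta> + \<eta> * (\<Sum>t=1..T. round_bound N l \<alpha> t)"
    using assms(1,3) \<eta> by (intro expectation_regret_le) auto
  also have "\<dots> \<le> ln (real N) / \<eta> + \<eta> * (Q / 4)" using b by simp
  also have "\<dots> = sqrt (Q * ln (real N))"
  proof -
    \<comment> \<open>In terms of these square roots the identity is rational: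
      \<open>\<eta> = 2 * a / b\<close> balances the two summands, each being
      \<open>a * b / 2\<close>.\<close>
    define a b where "a = sqrt (ln (real N))" and "b = sqrt Q"
    have ab: "a > 0" "b > 0" "ln (real N) = a\<^sup>2" "Q = b\<^sup>2"
      using lnN assms(4) by (auto simp: a_def b_def)
    have \<eta>_eq: "\<eta> = 2 * a / b"
      unfolding assms(6) ab(3,4) using ab(1,2) by (simp add: real_sqrt_mult real_sqrt_divide)
    then show ?thesis
      unfolding ab(3,4) \<eta>_eq using ab(1,2)
      by (simp add: real_sqrt_mult field_simps power2_eq_square)
  qed
  finally show ?thesis .
qed

end
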